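(* Let $(\Omega,\mathcal{F})$ be a measurable space, $T:\Omega\to\Omega$ measurable, and $V$ a $T$-invariant upper probability which is ergodic. Then the following are equivalent: (i) $\lim_{n\to\infty}\int\frac{1}{n}\sum_{i=0}^{n-1}1_B\cdot(1_C\circ T^i)\,dV=V(B)V(C)$ for all $B,C\in\mathcal{F}$; (ii) $V$ is a probability (i.e. $\sigma$-additive).
   Context: A capacity is a monotone map $\mu:\mathcal{F}\to[0,1]$ with $\mu(\emptyset)=0,\mu(\Omega)=1$. An upper probability is a capacity $V$ with $V(A)=\max_{P\in\Lambda}P(A)$ for a weak* (setwise convergence) compact set $\Lambda$ of probabilities. $V$ is $T$-invariant if $V(T^{-1}A)=V(A)$ for all $A$; with $\mathcal{I}=\{A:T^{-1}A=A\}$, $V$ is ergodic if for each $B\in\mathcal{I}$, $V(B)\in\{0,1\}$ and ($V(B)=0$ or $V(B^c)=0$). The integral with respect to a capacity $\mu$ is the Choquet integral $\int f\,d\mu=\int_0^\infty\mu(\{f\ge t\})dt+\int_{-\infty}^0(\mu(\{f\ge t\})-1)dt$. *)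

theory Defs
  imports "HOL-Probability.Probability"
begin

text \<open>An upper probability on the measurable space M: V A = max over a
weak* (setwise convergence) compact set \<Lambda> of probability measures on M.
Each probability P is identified with its set function restricted to sets M;
the setwise-convergence topology is then the product topology on
functions sets M \<rightarrow> real.\<close>

definition setwise_embed :: "'a measure \<Rightarrow> 'a measure \<Rightarrow> ('a set \<Rightarrow> real)" where
  "setwise_embed M P = restrict (measure P) (sets M)"

definition upper_probability :: "'a measure \<Rightarrow> ('a set \<Rightarrow> real) \<Rightarrow> bool" where
  "upper_probability M V \<longleftrightarrow>
     (\<exists>\<Lambda>. (\<forall>P\<in>\<Lambda>. prob_space P \<and> sets P = sets M \<and> space P = space M)
        \<and> compactin (product_topology (\<lambda>_. euclideanreal) (sets M)) (setwise_embed M ` \<Lambda>)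
        \<and> (\<forall>A\<in>sets M. \<exists>P\<in>\<Lambda>. V A = measure P A \<and> (\<forall>Q\<in>\<Lambda>. measure Q A \<le> V A)))"

definition T_invariant :: "'a measure \<Rightarrow> ('a \<Rightarrow> 'a) \<Rightarrow> ('a set \<Rightarrow> real) \<Rightarrow> bool" where
  "T_invariant M T V \<longleftrightarrow> (\<forall>A\<in>sets M. V (T -` A \<inter> space M) = V A)"

definition invariant_sets :: "'a measure \<Rightarrow> ('a \<Rightarrow> 'a) \<Rightarrow> 'a set set" where
  "invariant_sets M T = {A\<in>sets M. T -` A \<inter> space M = A}"

definition ergodic_cap :: "'a measure \<Rightarrow> ('a \<Rightarrow> 'a) \<Rightarrow> ('a set \<Rightarrow> real) \<Rightarrow> bool" where
  "ergodic_cap M T V \<longleftrightarrow> (\<forall>B\<in>invariant_sets M T.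
      (V B = 0 \<or> V B = 1) \<and> (V B = 0 \<or> V (space M - B) = 0))"

definition choquet :: "'a measure \<Rightarrow> ('a set \<Rightarrow> real) \<Rightarrow> ('a \<Rightarrow> real) \<Rightarrow> real" where
  "choquet M V f =
     (LBINT t:{0..}. V {x\<in>space M. t \<le> f x}) +
     (LBINT t:{..<0}. V {x\<in>space M. t \<le> f x} - 1)"

definition sigma_additive_cap :: "'a measure \<Rightarrow> ('a set \<Rightarrow> real) \<Rightarrow> bool" where
  "sigma_additive_cap M V \<longleftrightarrow>
     (\<forall>A :: nat \<Rightarrow> 'a set. range A \<subseteq> sets M \<longrightarrow> disjoint_family A \<longrightarrow>
        (\<lambda>n. V (A n)) sums V (\<Union>n. A n))"

end

theory Submission
  imports Defs
begin

text \<open>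
  The invariant \<open>V\<close> dominates a \<open>T\<close>-invariant probability \<open>Q\<close>: a cluster point of the averages of
  \<open>P \<circ> T\<^sup>-\<^sup>i\<close> is finitely additive, and \<open>\<sigma>\<close>-additive because compactness of \<open>\<Lambda>\<close>
  makes \<open>V\<close> continuous at \<open>\<emptyset>\<close>. By the maximal ergodic argument under \<open>Q\<close>, a bounded \<open>f\<close> with
  \<open>\<integral>f dQ < 0\<close> has Birkhoff sums that are unbounded above only on an invariant \<open>Q\<close>-null set, and
  ergodicity of \<open>V\<close> upgrades this to a \<open>V\<close>-null set. Hence the averages of \<open>1\<^sub>C \<circ> T\<^sup>i\<close> converge to
  \<open>Q(C)\<close> in \<open>V\<close>, and the Choquet integrals in (i) always converge to \<open>V(B) Q(C)\<close>. So (i) says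
  \<open>V = Q\<close>, which is equivalent to (ii) since \<open>Q \<le> V\<close>.
\<close>

section \<open>Upper probabilities\<close>

lemma upper_probabilityE:
  assumes "upper_probability M V"
  obtains \<Lambda> where "\<And>P. P \<in> \<Lambda> \<Longrightarrow> prob_space P" "\<And>P. P \<in> \<Lambda> \<Longrightarrow> sets P = sets M"
    "\<And>P. P \<in> \<Lambda> \<Longrightarrow> space P = space M"
    "compactin (product_topology (\<lambda>_. euclideanreal) (sets M)) (setwise_embed M ` \<Lambda>)"
    "\<And>A. A \<in> sets M \<Longrightarrow> \<exists>P\<in>\<Lambda>. V A = measure P A"
    "\<And>A P. A \<in> sets M \<Longrightarrow> P \<in> \<Lambda> \<Longrightarrow> measure P A \<le> V A"
  using assms unfolding upper_probability_def by metis

context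
  fixes M :: "'a measure" and V :: "'a set \<Rightarrow> real"
  assumes V: "upper_probability M V"
begin

lemma upper_probability_nonneg: "A \<in> sets M \<Longrightarrow> 0 \<le> V A"
  by (rule upper_probabilityE[OF V]) (metis measure_nonneg)

lemma upper_probability_le_1: "A \<in> sets M \<Longrightarrow> V A \<le> 1"
  by (rule upper_probabilityE[OF V]) (metis prob_space.prob_le_1)

lemma upper_probability_space: "V (space M) = 1"
  by (rule upper_probabilityE[OF V]) (metis prob_space.prob_space sets.top)

lemma upper_probability_empty: "V {} = 0"
  by (rule upper_probabilityE[OF V]) (metis measure_empty sets.empty_sets)

lemma upper_probability_mono:
  assumes "A \<in> sets M" "B \<in> sets M" "A \<subseteq> B"
  shows "V A \<le> V B"
proof (rule upper_probabilityE[OF V])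
  fix \<Lambda> assume *: "\<And>P. P \<in> \<Lambda> \<Longrightarrow> prob_space P" "\<And>P. P \<in> \<Lambda> \<Longrightarrow> sets P = sets M"
    "\<And>A. A \<in> sets M \<Longrightarrow> \<exists>P\<in>\<Lambda>. V A = measure P A"
    "\<And>A P. A \<in> sets M \<Longrightarrow> P \<in> \<Lambda> \<Longrightarrow> measure P A \<le> V A"
  obtain P where P: "P \<in> \<Lambda>" "V A = measure P A" using *(3) assms by blast
  interpret prob_space P using * P by auto
  have "measure P A \<le> measure P B"
    using assms * P by (intro finite_measure_mono) auto
  with P *(4)[OF assms(2)] show ?thesis by force
qed

lemma upper_probability_subadditive:
  assumes "A \<in> sets M" "B \<in> sets M"
  shows "V (A \<union> B) \<le> V A + V B"
proof (rule upper_probabilityE[OF V])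
  fix \<Lambda> assume *: "\<And>P. P \<in> \<Lambda> \<Longrightarrow> prob_space P" "\<And>P. P \<in> \<Lambda> \<Longrightarrow> sets P = sets M"
    "\<And>A. A \<in> sets M \<Longrightarrow> \<exists>P\<in>\<Lambda>. V A = measure P A"
    "\<And>A P. A \<in> sets M \<Longrightarrow> P \<in> \<Lambda> \<Longrightarrow> measure P A \<le> V A"
  have "A \<union> B \<in> sets M" using assms by auto
  then obtain P where P: "P \<in> \<Lambda>" "V (A \<union> B) = measure P (A \<union> B)" using *(3) by blast
  interpret prob_space P using * P by auto
  have "measure P (A \<union> B) \<le> measure P A + measure P B"
    using assms * P by (intro measure_Un_le) auto
  with P *(4)[OF assms(1)] *(4)[OF assms(2)] show ?thesis by force
qed

text \<open>Lets events that agree outside an exceptional set \<open>D\<close> be compared although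
  \<open>V\<close> is only subadditive. It is used later for the level sets of the averages.\<close>

lemma upper_probability_diff_le:
  assumes "A \<in> sets M" "B \<in> sets M" "D \<in> sets M" "A \<subseteq> B \<union> D" "B \<subseteq> A \<union> D"
  shows "\<bar>V A - V B\<bar> \<le> V D"
proof -
  have "V A \<le> V (B \<union> D)" "V B \<le> V (A \<union> D)"
    using assms by (auto intro!: upper_probability_mono)
  then show ?thesis
    using upper_probability_subadditive[of B D] upper_probability_subadditive[of A D] assms
    by auto
qed

text \<open>A Dini argument: each \<open>P\<close> in \<Lambda> is small on \<open>A n\<close> from
  some n on, and compactness with monotonicity makes that n uniform over \<Lambda>. As
  \<open>V (A n)\<close> is attained in \<Lambda>, it is small too.\<close>

lemma upper_probability_continuous_null:
  assumes A: "range A \<subseteq> sets M" "decseq A" "V (\<Inter>n. A n) = 0"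
  shows "(\<lambda>n. V (A n)) \<longlonglongrightarrow> 0"
proof (rule upper_probabilityE[OF V])
  fix \<Lambda> assume prob: "\<And>P. P \<in> \<Lambda> \<Longrightarrow> prob_space P" and sets: "\<And>P. P \<in> \<Lambda> \<Longrightarrow> sets P = sets M"
    and cpt: "compactin (product_topology (\<lambda>_. euclideanreal) (sets M)) (setwise_embed M ` \<Lambda>)"
    and att: "\<And>A. A \<in> sets M \<Longrightarrow> \<exists>P\<in>\<Lambda>. V A = measure P A"
    and le: "\<And>A P. A \<in> sets M \<Longrightarrow> P \<in> \<Lambda> \<Longrightarrow> measure P A \<le> V A"
  let ?X = "product_topology (\<lambda>_. euclideanreal) (sets M)"
  have AM: "A n \<in> sets M" for n using A by auto
  show ?thesis
  proof (rule LIMSEQ_I)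
    fix e :: real assume "e > 0"
    \<comment> \<open>\<open>U n\<close> is open because evaluation at the coordinate
      \<open>A n\<close> is continuous in the product topology.\<close>
    define U where "U n = {p \<in> topspace ?X. p (A n) < e}" for n
    have op: "openin ?X (U n)" for n
    proof -
      have "continuous_map ?X euclideanreal (\<lambda>p. p (A n))"
        using AM by (rule continuous_map_product_projection)
      from openin_continuous_map_preimage[OF this, of "{..<e}"] show ?thesis
        by (simp add: U_def)
    qed
    have "setwise_embed M ` \<Lambda> \<subseteq> \<Union>(range U)"
    proof clarify
      fix P assume P: "P \<in> \<Lambda>"
      interpret prob_space P using prob P by auto
      have "(\<lambda>n. measure P (A n)) \<longlonglongrightarrow> measure P (\<Inter>n. A n)"
        using A sets[OF P] by (intro finite_Lim_measure_decseq) auto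
      moreover have "measure P (\<Inter>n. A n) = 0"
        using le[OF _ P, of "\<Inter>n. A n"] AM A(3) by (simp add: measure_le_0_iff)
      ultimately have "\<forall>\<^sub>F n in sequentially. measure P (A n) < e"
        using \<open>e > 0\<close> by (metis order_tendstoD(2))
      then obtain n where "measure P (A n) < e" by (auto simp: eventually_sequentially)
      then have "setwise_embed M P \<in> U n"
        using AM by (auto simp: U_def setwise_embed_def)
      then show "setwise_embed M P \<in> \<Union>(range U)" by blast
    qed
    then obtain F where F: "finite F" "F \<subseteq> range U" "setwise_embed M ` \<Lambda> \<subseteq> \<Union>F"
      using compactinD[OF cpt, of "range U"] op by blast
    then obtain I where I: "finite I" "F = U ` I" by (meson finite_subset_image)
    \<comment> \<open>Inserting 0 keeps \<open>Max\<close> meaningful if the subcover is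
      empty.\<close>
    define N where "N = Max (insert 0 I)"
    have "V (A n) < e" if n: "n \<ge> N" for n
    proof -
      obtain P where P: "P \<in> \<Lambda>" "V (A n) = measure P (A n)" using att AM by blast
      interpret prob_space P using prob P by auto
      obtain i where i: "i \<in> I" "setwise_embed M P \<in> U i" using F I P by blast
      have "i \<le> n" using i I n unfolding N_def by simp
      have "measure P (A n) \<le> measure P (A i)"
        using sets P AM decseqD[OF A(2) \<open>i \<le> n\<close>] by (intro finite_measure_mono) auto
      also have "\<dots> < e" using i AM by (simp add: U_def setwise_embed_def)
      finally show ?thesis using P by simp
    qed
    then show "\<exists>N. \<forall>n\<ge>N. norm (V (A n) - 0) < e"
      using upper_probability_nonneg[OF AM] by auto
  qed
qed

end

section \<open>An invariant probability below an invariant upper probability\<close>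

text \<open>A cluster point stands in for the limit of a subsequence, which may fail to exist in a
  cube with uncountably many coordinates. It inherits every closed condition that holds eventually
  along the sequence.\<close>

lemma compact_sequence_cluster_point:
  fixes p :: "nat \<Rightarrow> 'b::topological_space"
  assumes "compact K" "\<And>n. p n \<in> K"
  obtains q where "\<And>S. closed S \<Longrightarrow> eventually (\<lambda>n. p n \<in> S) sequentially \<Longrightarrow> q \<in> S"
proof -
  have "filtermap p sequentially \<noteq> bot" by (simp add: filtermap_bot_iff)
  moreover have "eventually (\<lambda>x. x \<in> K) (filtermap p sequentially)"
    using assms by (simp add: eventually_filtermap)
  ultimately obtain q where q: "inf (nhds q) (filtermap p sequentially) \<noteq> bot"
    using assms(1) unfolding compact_filter by blast
  have "q \<in> S" if S: "closed S" "eventually (\<lambda>n. p n \<in> S) sequentially" for S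
  proof (rule ccontr)
    assume "q \<notin> S"
    then have "eventually (\<lambda>x. x \<in> - S) (nhds q)"
      using S by (intro eventually_nhds_in_open) auto
    moreover have "eventually (\<lambda>x. x \<in> S) (filtermap p sequentially)"
      using S by (simp add: eventually_filtermap)
    ultimately have "eventually (\<lambda>x. False) (inf (nhds q) (filtermap p sequentially))"
      unfolding eventually_inf by (metis ComplD)
    with q show False by (simp add: trivial_limit_def)
  qed
  then show ?thesis using that by blast
qed

text \<open>Tychonoff's theorem, for total functions so that the topology of the function type can
  be used.\<close>

lemma compact_unit_cube: "compact {p :: 'b \<Rightarrow> real. \<forall>x. p x \<in> {0..1}}"
proof -
  have "compactin (product_topology (\<lambda>_. euclideanreal) (UNIV :: 'b set)) (PiE UNIV (\<lambda>_. {0..1}))"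
    by (simp add: compactin_PiE)
  moreover have "PiE UNIV (\<lambda>_. {0..1}) = {p :: 'b \<Rightarrow> real. \<forall>x. p x \<in> {0..1}}"
    by (auto simp: PiE_def Pi_def)
  ultimately show ?thesis by (simp add: euclidean_product_topology)
qed

lemma measurable_funpow:
  assumes "T \<in> M \<rightarrow>\<^sub>M M"
  shows "T ^^ n \<in> M \<rightarrow>\<^sub>M M"
proof (induction n)
  case (Suc n)
  show ?case unfolding funpow.simps by (rule measurable_comp[OF Suc assms])
qed (simp add: id_def)

lemma invariant_funpow:
  assumes T: "T \<in> M \<rightarrow>\<^sub>M M" and inv: "T_invariant M T V" and A: "A \<in> sets M"
  shows "V ((T ^^ n) -` A \<inter> space M) = V A"
  using A
proof (induction n arbitrary: A)
  case 0
  then show ?case using sets.sets_into_space by (simp add: Int_absorb2)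
next
  case (Suc n)
  have "(T ^^ Suc n) -` A \<inter> space M = (T ^^ n) -` (T -` A \<inter> space M) \<inter> space M"
    using measurable_space[OF measurable_funpow[OF T]] by auto
  with Suc T inv show ?case by (simp add: T_invariant_def del: funpow.simps vimage_Int)
qed

text \<open>The Krylov-Bogolyubov construction, with domination by \<open>V\<close> supplying the
  countable additivity of the cluster point.\<close>

lemma invariant_probability_below:
  assumes T: "T \<in> M \<rightarrow>\<^sub>M M" and V: "upper_probability M V" and inv: "T_invariant M T V"
  obtains Q where "prob_space Q" "sets Q = sets M" "\<forall>A\<in>sets M. measure Q A \<le> V A"
    "T_invariant M T (measure Q)"
proof -
  obtain P where P: "prob_space P" "sets P = sets M"
    and PV: "\<And>A. A \<in> sets M \<Longrightarrow> measure P A \<le> V A"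
    by (rule upper_probabilityE[OF V]) (metis sets.empty_sets)
  interpret P: prob_space P by fact
  have spP: "space P = space M" using P sets_eq_imp_space_eq by blast
  define m where "m i A = measure P ((T ^^ i) -` A \<inter> space M)" for i A
  \<comment> \<open>Averaging over \<open>Suc n\<close> terms gives total mass 1 for every n,
    including n = 0.\<close>
  define p where "p n A = (\<Sum>i<Suc n. m i A) / real (Suc n)" for n A
  have ms[measurable]: "(T ^^ i) -` A \<inter> space M \<in> sets M" if "A \<in> sets M" for i A
    using measurable_funpow[OF T] that by (rule measurable_sets)
  have avg: "(\<Sum>i<Suc n. g i) / real (Suc n) \<le> c" if "\<And>i. g i \<le> c" for g :: "nat \<Rightarrow> real" and c n
    using sum_bounded_above[of "{..<Suc n}" g c] that by (simp add: divide_le_eq mult.commute)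
  have m01: "0 \<le> m i A" "m i A \<le> 1" for i A by (auto simp: m_def)
  have p01: "p n A \<in> {0..1}" for n A
    using avg[of "\<lambda>i. m i A" 1 n] m01 sum_nonneg[of "{..<Suc n}" "\<lambda>i. m i A"]
    by (simp add: p_def del: sum.lessThan_Suc)
  obtain q where q: "\<And>S. closed S \<Longrightarrow> eventually (\<lambda>n. p n \<in> S) sequentially \<Longrightarrow> q \<in> S"
    by (rule compact_sequence_cluster_point[OF compact_unit_cube, of p]) (use p01 in auto)
  \<comment> \<open>Each property of \<open>q\<close> below comes from a closed condition on
    finitely many coordinates that all \<open>p n\<close> satisfy, at least eventually.\<close>
  have q0: "0 \<le> q A" for A
    using q[of "{p. 0 \<le> p A}"] p01
    by (simp add: closed_Collect_le)
  have qV: "q A \<le> V A" if "A \<in> sets M" for A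
  proof -
    have "m i A \<le> V A" for i
      using PV[OF ms[OF that]] invariant_funpow[OF T inv that] by (simp add: m_def)
    then have "p n A \<le> V A" for n unfolding p_def by (rule avg)
    then show ?thesis
      using q[of "{p. p A \<le> V A}"] by (simp add: closed_Collect_le)
  qed
  have q1: "q (space M) = 1"
  proof -
    have "(T ^^ i) -` space M \<inter> space M = space M" for i
      using measurable_space[OF measurable_funpow[OF T]] by auto
    then have "p n (space M) = 1" for n
      using P.prob_space by (simp add: p_def m_def spP)
    then show ?thesis
      using q[of "{p. p (space M) = 1}"]
      by (simp add: closed_Collect_eq)
  qed
  have qadd: "q (A \<union> B) = q A + q B" if "A \<in> sets M" "B \<in> sets M" "A \<inter> B = {}" for A B
  proof -
    have "m i (A \<union> B) = m i A + m i B" for i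
      unfolding m_def
      using ms[of _ i] that P
      by (subst P.finite_measure_Union[symmetric]) (auto intro: arg_cong[where f="measure P"])
    then have "p n (A \<union> B) = p n A + p n B" for n
      by (simp add: p_def sum.distrib add_divide_distrib)
    then show ?thesis
      using q[of "{p. p (A \<union> B) = p A + p B}"]
      by (simp add: closed_Collect_eq continuous_on_add)
  qed
  have qinv: "q (T -` A \<inter> space M) = q A" if A: "A \<in> sets M" for A
  proof -
    let ?A = "T -` A \<inter> space M"
    have "(T ^^ Suc i) -` A \<inter> space M = (T ^^ i) -` ?A \<inter> space M" for i
      using measurable_space[OF measurable_funpow[OF T]] by auto
    then have "m i ?A = m (Suc i) A" for i by (simp add: m_def)
    \<comment> \<open>Replacing \<open>A\<close> by its preimage shifts the average by one index, so
      all but the two end terms cancel. The averages are thus invariant up to 1/(n+1), and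
      \<open>q\<close> exactly.\<close>
    then have *: "p n ?A - p n A = (m (Suc n) A - m 0 A) / real (Suc n)" for n
      using sum_lessThan_telescope[of "\<lambda>i. m i A" "Suc n"]
      by (simp add: p_def flip: diff_divide_distrib sum_subtractf del: sum.lessThan_Suc)
    have bd: "\<bar>p n ?A - p n A\<bar> \<le> 1 / real (Suc n)" for n
      unfolding * using m01[of "Suc n" A] m01[of 0 A] by (simp add: divide_right_mono abs_le_iff)
    have "\<bar>q ?A - q A\<bar> \<le> e" if "e > 0" for e
    proof -
      have "\<forall>\<^sub>F n in sequentially. 1 / real (Suc n) < e"
        using LIMSEQ_inverse_real_of_nat \<open>e > 0\<close>
        by (auto simp: inverse_eq_divide dest!: order_tendstoD(2))
      then have "\<forall>\<^sub>F n in sequentially. \<bar>p n ?A - p n A\<bar> \<le> e"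
        by eventually_elim (use bd in \<open>meson less_imp_le order_trans\<close>)
      then show ?thesis
        using q[of "{p. \<bar>p ?A - p A\<bar> \<le> e}"]
        by (simp add: closed_Collect_le continuous_on_diff continuous_on_rabs)
    qed
    then show ?thesis by (metis abs_le_zero_iff eq_iff_diff_eq_0 field_le_epsilon add_0)
  qed
  define Q where "Q = measure_of (space M) (sets M) (\<lambda>A. ennreal (q A))"
  have setsQ: "sets Q = sets M" by (simp add: Q_def)
  have spQ: "space Q = space M" by (simp add: Q_def)
  have qe: "q {} = 0" using qadd[of "{}" "{}"] by simp
  have pos: "positive (sets M) (\<lambda>A. ennreal (q A))" by (simp add: positive_def qe)
  have ca: "countably_additive (sets M) (\<lambda>A. ennreal (q A))"
  \<comment> \<open>For a finite additive set function, continuity at the empty set suffices; it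
    holds since \<open>q\<close> is squeezed between 0 and \<open>V\<close>.\<close>
  proof (rule sets.empty_continuous_imp_countably_additive[OF pos])
    show "additive (sets M) (\<lambda>A. ennreal (q A))"
      using qadd q0 by (auto simp: additive_def)
    fix A :: "nat \<Rightarrow> 'a set" assume A: "range A \<subseteq> sets M" "decseq A" "(\<Inter>i. A i) = {}"
    have "(\<lambda>n. V (A n)) \<longlonglongrightarrow> 0"
      using A upper_probability_empty[OF V] by (intro upper_probability_continuous_null[OF V]) auto
    then have "(\<lambda>n. q (A n)) \<longlonglongrightarrow> 0"
      using A qV q0
      by (auto intro!: always_eventually real_tendsto_sandwich[OF _ _ tendsto_const, where h="\<lambda>n. V (A n)"])
    then show "(\<lambda>i. ennreal (q (A i))) \<longlonglongrightarrow> 0" using tendsto_ennrealI by fastforce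
  qed simp
  have emQ: "emeasure Q A = ennreal (q A)" if "A \<in> sets M" for A
    unfolding Q_def using that pos ca by (intro emeasure_measure_of_sigma sets.sigma_algebra_axioms)
  have mQ: "measure Q A = q A" if "A \<in> sets M" for A
    using emQ[OF that] q0 by (simp add: measure_def)
  have "prob_space Q" by (rule prob_spaceI) (simp add: spQ emQ q1)
  then show ?thesis
    using that[of Q] setsQ mQ qV qinv measurable_sets[OF T] by (simp add: T_invariant_def)
qed

section \<open>The maximal ergodic argument\<close>

text \<open>This is \<open>max\<close> over \<open>k \<le> n\<close> of the Birkhoff sums of length \<open>k\<close>. The recursion gives
  \<open>m\<^sub>n\<^sub>+\<^sub>1 - m\<^sub>n \<circ> T = max (- m\<^sub>n \<circ> T) f\<close>, whose integral is nonnegative by invariance and which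
  tends to \<open>f\<close> where the sums are unbounded.\<close>

primrec max_birkhoff_sum :: "('a \<Rightarrow> 'a) \<Rightarrow> ('a \<Rightarrow> real) \<Rightarrow> nat \<Rightarrow> 'a \<Rightarrow> real" where
  "max_birkhoff_sum T f 0 = (\<lambda>x. 0)"
| "max_birkhoff_sum T f (Suc n) = (\<lambda>x. max 0 (f x + max_birkhoff_sum T f n (T x)))"

text \<open>Splitting off the first term instead of the last matches the recursion of
  \<open>max_birkhoff_sum\<close> through \<open>T x\<close>.\<close>

lemma birkhoff_sum_Suc:
  fixes f :: "'a \<Rightarrow> real"
  shows "(\<Sum>i<Suc n. f ((T ^^ i) x)) = f x + (\<Sum>i<n. f ((T ^^ i) (T x)))"
  by (subst sum.lessThan_Suc_shift) (simp add: funpow_swap1)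

lemma max_birkhoff_sum_nonneg: "0 \<le> max_birkhoff_sum T f n x"
  by (cases n) auto

lemma max_birkhoff_sum_le_Suc: "max_birkhoff_sum T f n x \<le> max_birkhoff_sum T f (Suc n) x"
proof (induction n arbitrary: x)
  case (Suc n)
  from Suc[of "T x"] show ?case by simp
qed simp

lemma birkhoff_sum_le_max_birkhoff_sum:
  "k \<le> n \<Longrightarrow> (\<Sum>i<k. f ((T ^^ i) x)) \<le> max_birkhoff_sum T f n x"
proof (induction n arbitrary: k x)
  case (Suc n)
  show ?case
  proof (cases k)
    case (Suc j)
    with Suc.IH[of j "T x"] Suc.prems show ?thesis
      unfolding Suc birkhoff_sum_Suc by simp
  qed (simp add: max_birkhoff_sum_nonneg del: max_birkhoff_sum.simps)
qed simp

lemma max_birkhoff_sum_bounded: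
  assumes "\<And>x. \<bar>f x\<bar> \<le> c"
  shows "max_birkhoff_sum T f n x \<le> real n * c"
proof (induction n arbitrary: x)
  case (Suc n)
  have "0 \<le> c" using assms[of x] by linarith
  with Suc[of "T x"] assms[of x] show ?case by (auto simp: algebra_simps)
qed simp

lemma measurable_max_birkhoff_sum:
  assumes [measurable]: "T \<in> M \<rightarrow>\<^sub>M M" "f \<in> borel_measurable M"
  shows "max_birkhoff_sum T f n \<in> borel_measurable M"
  by (induction n) auto

lemma integral_nonneg_if_birkhoff_sums_unbounded:
  fixes f :: "'a \<Rightarrow> real"
  assumes "prob_space Q" and T[measurable]: "T \<in> Q \<rightarrow>\<^sub>M Q" and inv: "distr Q Q T = Q"
    and f[measurable]: "f \<in> borel_measurable Q" and bd: "\<And>x. \<bar>f x\<bar> \<le> c"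
    and unb: "AE x in Q. \<forall>K. \<exists>n. K < (\<Sum>i<n. f ((T ^^ i) x))"
  shows "0 \<le> integral\<^sup>L Q f"
proof -
  interpret prob_space Q by fact
  let ?m = "max_birkhoff_sum T f"
  note [measurable] = measurable_max_birkhoff_sum[OF T f]
  have c0: "0 \<le> c" using bd[of undefined] by linarith
  have int: "integrable Q (?m n)" for n
    using max_birkhoff_sum_bounded[of f c T n, OF bd]
    by (intro integrable_const_bound[where B="real n * c"]) (auto simp: max_birkhoff_sum_nonneg)
  have intT: "integrable Q (\<lambda>x. ?m n (T x))" for n
    using int[of n] by (subst (asm) inv[symmetric]) (simp add: integrable_distr_eq)
  have eqT: "(\<integral>x. ?m n (T x) \<partial>Q) = integral\<^sup>L Q (?m n)" for n
    by (subst (2) inv[symmetric]) (simp add: integral_distr)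
  let ?g = "\<lambda>n x. ?m (Suc n) x - ?m n (T x)"
  have "0 \<le> integral\<^sup>L Q (?g n)" for n
  proof -
    have "integral\<^sup>L Q (?m n) \<le> integral\<^sup>L Q (?m (Suc n))"
      using max_birkhoff_sum_le_Suc by (intro integral_mono int)
    then show ?thesis
      using Bochner_Integration.integral_diff[OF int[of "Suc n"] intT[of n]] eqT[of n] by linarith
  qed
  moreover have "(\<lambda>n. integral\<^sup>L Q (?g n)) \<longlonglongrightarrow> integral\<^sup>L Q f"
  proof (rule integral_dominated_convergence[where w="\<lambda>_. c"])
    show "AE x in Q. (\<lambda>n. ?g n x) \<longlonglongrightarrow> f x"
      using unb
    proof eventually_elim
      case (elim x)
      then obtain n where n: "c < (\<Sum>i<n. f ((T ^^ i) x))" by blast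
      with c0 obtain k where k: "n = Suc k" by (cases n) auto
      \<comment> \<open>With n = k + 1, \<open>f x + ?m j (T x)\<close> is at least the sum of
        length n, hence positive. The outer maximum with 0 is then inactive and the difference is
        \<open>f x\<close>.\<close>
      have "?g j x = f x" if "j \<ge> k" for j
        using n birkhoff_sum_le_max_birkhoff_sum[OF that, of f T "T x"]
        unfolding k birkhoff_sum_Suc using bd[of x] c0 by simp
      then have "\<forall>\<^sub>F j in sequentially. ?g j x = f x"
        unfolding eventually_sequentially by blast
      then show ?case by (rule tendsto_eventually)
    qed
    show "AE x in Q. norm (?g n x) \<le> c" for n
    proof (rule AE_I2)
      fix x
      show "norm (?g n x) \<le> c"
        \<comment> \<open>The difference is the maximum of \<open>f x\<close> and a nonpositive
          number, so it lies between -c and c uniformly in n.\<close>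
        using bd[of x] c0 max_birkhoff_sum_nonneg[of T f n "T x"] by (auto simp: max_def)
    qed
  qed auto
  ultimately show ?thesis by (intro LIMSEQ_le_const) auto
qed

section \<open>Ergodic averages\<close>

text \<open>Thresholds \<open>K\<close> range over naturals to make this a countable combination of
  measurable sets.\<close>

definition unbounded_sums :: "'a measure \<Rightarrow> ('a \<Rightarrow> 'a) \<Rightarrow> ('a \<Rightarrow> real) \<Rightarrow> 'a set" where
  "unbounded_sums M T f = {x \<in> space M. \<forall>K::nat. \<exists>n. real K < (\<Sum>i<n. f ((T ^^ i) x))}"

lemma unbounded_sums_iff:
  assumes "x \<in> space M"
  shows "x \<in> unbounded_sums M T f \<longleftrightarrow> (\<forall>K. \<exists>n. K < (\<Sum>i<n. f ((T ^^ i) x)))"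
  using assms unfolding unbounded_sums_def by (auto, meson le_less_trans real_arch_simple)

text \<open>Passing from \<open>x\<close> to \<open>T x\<close> drops the first term, which changes
  all sums by the fixed number \<open>f x\<close> and cannot affect unboundedness above.\<close>

lemma unbounded_sums_invariant:
  assumes T: "T \<in> M \<rightarrow>\<^sub>M M" and [measurable]: "f \<in> borel_measurable M"
  shows "unbounded_sums M T f \<in> invariant_sets M T"
proof -
  note [measurable] = measurable_funpow[OF T]
  have "unbounded_sums M T f \<in> sets M" unfolding unbounded_sums_def by measurable
  moreover have "T x \<in> unbounded_sums M T f \<longleftrightarrow> x \<in> unbounded_sums M T f" if x: "x \<in> space M" for x
  proof -
    have Tx: "T x \<in> space M" using T x by (rule measurable_space)
    have "(\<forall>K. \<exists>n. K < (\<Sum>i<n. f ((T ^^ i) (T x)))) \<longleftrightarrow> (\<forall>K. \<exists>n. K < (\<Sum>i<n. f ((T ^^ i) x)))"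
    proof (intro iffI allI)
      fix K assume "\<forall>K. \<exists>n. K < (\<Sum>i<n. f ((T ^^ i) (T x)))"
      then obtain n where "K - f x < (\<Sum>i<n. f ((T ^^ i) (T x)))" by blast
      then have "K < (\<Sum>i<Suc n. f ((T ^^ i) x))" unfolding birkhoff_sum_Suc by linarith
      then show "\<exists>n. K < (\<Sum>i<n. f ((T ^^ i) x))" by blast
    next
      fix K assume "\<forall>K. \<exists>n. K < (\<Sum>i<n. f ((T ^^ i) x))"
      \<comment> \<open>The maximum with 0 rules out the empty sum, so a first term can be split
        off.\<close>
      then obtain n where n: "max 0 (K + f x) < (\<Sum>i<n. f ((T ^^ i) x))" by blast
      then obtain k where "n = Suc k" by (cases n) auto
      with n have "K < (\<Sum>i<k. f ((T ^^ i) (T x)))" unfolding \<open>n = Suc k\<close> birkhoff_sum_Suc by linarith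
      then show "\<exists>n. K < (\<Sum>i<n. f ((T ^^ i) (T x)))" by blast
    qed
    with x Tx show ?thesis by (simp add: unbounded_sums_iff)
  qed
  ultimately show ?thesis by (auto simp: invariant_sets_def dest: sets.sets_into_space)
qed

context
  fixes M :: "'a measure" and T :: "'a \<Rightarrow> 'a" and V :: "'a set \<Rightarrow> real" and Q :: "'a measure"
  assumes T: "T \<in> M \<rightarrow>\<^sub>M M" and V: "upper_probability M V" and erg: "ergodic_cap M T V"
    and Q: "prob_space Q" and sets_Q[measurable_cong]: "sets Q = sets M"
    and Q_le: "\<forall>A\<in>sets M. measure Q A \<le> V A" and Q_inv: "T_invariant M T (measure Q)"
begin

interpretation Q: prob_space Q by (rule Q)

text \<open>Otherwise ergodicity makes the complement \<open>V\<close>-null, hence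
  \<open>Q\<close>-null as \<open>Q\<close> \<le> \<open>V\<close>. The sums would then be unbounded
  \<open>Q\<close>-almost everywhere, forcing a nonnegative integral.\<close>

lemma unbounded_sums_null:
  assumes f[measurable]: "f \<in> borel_measurable M" and bd: "\<And>x. \<bar>f x\<bar> \<le> c" and neg: "integral\<^sup>L Q f < 0"
  shows "V (unbounded_sums M T f) = 0"
proof (rule ccontr)
  let ?E = "unbounded_sums M T f"
  assume "V ?E \<noteq> 0"
  have E: "?E \<in> invariant_sets M T" using T f by (rule unbounded_sums_invariant)
  then have EM[measurable]: "?E \<in> sets M" by (simp add: invariant_sets_def)
  have "V (space M - ?E) = 0" using erg E \<open>V ?E \<noteq> 0\<close> by (auto simp: ergodic_cap_def)
  then have "measure Q (space M - ?E) = 0"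
    using bspec[OF Q_le, of "space M - ?E"] by (simp add: measure_le_0_iff)
  then have "AE x in Q. x \<notin> space M - ?E"
    by (intro AE_not_in) (simp add: null_sets_def Q.emeasure_eq_measure sets_Q)
  then have "AE x in Q. \<forall>K. \<exists>n. K < (\<Sum>i<n. f ((T ^^ i) x))"
    using AE_space by eventually_elim (auto simp: unbounded_sums_iff sets_eq_imp_space_eq[OF sets_Q])
  moreover have TQ[measurable]: "T \<in> Q \<rightarrow>\<^sub>M Q" using T by (simp add: measurable_cong_sets[OF sets_Q sets_Q])
  moreover have "distr Q Q T = Q"
    by (rule measure_eqI) (auto simp: emeasure_distr sets_eq_imp_space_eq[OF sets_Q] Q.emeasure_eq_measure sets_Q Q_inv[unfolded T_invariant_def])
  moreover have "f \<in> borel_measurable Q" by measurable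
  ultimately have "0 \<le> integral\<^sup>L Q f"
    using Q bd by (intro integral_nonneg_if_birkhoff_sums_unbounded)
  with neg show False by simp
qed

lemma averages_converge_in_upper_probability:
  assumes C[measurable]: "C \<in> sets M" and "\<delta> > 0"
  shows "(\<lambda>n. V {x \<in> space M. \<delta> \<le> \<bar>1 / real n * (\<Sum>i<n. indicator C ((T ^^ i) x)) - measure Q C\<bar>}) \<longlonglongrightarrow> 0"
proof -
  note [measurable] = measurable_funpow[OF T]
  let ?q = "measure Q C"
  define S :: "nat \<Rightarrow> 'a \<Rightarrow> real" where "S n x = (\<Sum>i<n. indicator C ((T ^^ i) x))" for n x
  define D where "D n = {x \<in> space M. \<delta> \<le> \<bar>1 / real n * S n x - ?q\<bar>}" for n
  \<comment> \<open>The events \<open>D n\<close> need not be monotone; their tail unions decrease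
    to the limsup event, so continuity at null sets applies.\<close>
  define G where "G n = (\<Union>k\<in>{n..}. D k)" for n
  have [measurable]: "S n \<in> borel_measurable M" for n unfolding S_def by measurable
  have DM[measurable]: "D n \<in> sets M" for n unfolding D_def by measurable
  have GM: "G n \<in> sets M" for n unfolding G_def by measurable
  \<comment> \<open>These test deviations above and below. Both have \<open>Q\<close>-integral
    -\<delta>/2, and the other half of \<delta> is kept to absorb the bound on the sums.\<close>
  define f1 f2 :: "'a \<Rightarrow> real"
    where "f1 = (\<lambda>x. indicator C x - (?q + \<delta>/2))" and "f2 = (\<lambda>x. (?q - \<delta>/2) - indicator C x)"
  have [measurable]: "f1 \<in> borel_measurable M" "f2 \<in> borel_measurable M"
    unfolding f1_def f2_def by measurable
  have CQ: "C \<in> sets Q" using C sets_Q by simp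
  have q01: "0 \<le> ?q" "?q \<le> 1" by auto
  have "integral\<^sup>L Q f1 < 0" "integral\<^sup>L Q f2 < 0"
    using \<open>\<delta> > 0\<close> CQ Q.prob_space by (simp_all add: f1_def f2_def Q.emeasure_eq_measure)
  moreover have "\<bar>f1 x\<bar> \<le> 2 + \<delta>" "\<bar>f2 x\<bar> \<le> 2 + \<delta>" for x
    using q01 \<open>\<delta> > 0\<close> by (auto simp: f1_def f2_def indicator_def abs_le_iff
        simp del: measure_nonneg Q.prob_le_1)
  ultimately have null: "V (unbounded_sums M T f1) = 0" "V (unbounded_sums M T f2) = 0"
    by (auto intro!: unbounded_sums_null[where c="2 + \<delta>"])
  have s1: "(\<Sum>i<n. f1 ((T ^^ i) x)) = S n x - n * (?q + \<delta>/2)"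
    and s2: "(\<Sum>i<n. f2 ((T ^^ i) x)) = n * (?q - \<delta>/2) - S n x" for n x
    by (simp_all add: f1_def f2_def S_def sum_subtractf)
  have UM: "unbounded_sums M T f1 \<in> sets M" "unbounded_sums M T f2 \<in> sets M"
    using unbounded_sums_invariant[OF T] by (auto simp: invariant_sets_def)
  have sub: "(\<Inter>n. G n) \<subseteq> unbounded_sums M T f1 \<union> unbounded_sums M T f2"
  proof (rule subsetI, rule ccontr)
    fix x assume x: "x \<in> (\<Inter>n. G n)" and nx: "x \<notin> unbounded_sums M T f1 \<union> unbounded_sums M T f2"
    have xM: "x \<in> space M" using x by (auto simp: G_def D_def)
    obtain K1 where K1: "\<And>n. S n x - n * (?q + \<delta>/2) \<le> K1"
      using nx xM by (auto simp: unbounded_sums_iff s1 not_less)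
    obtain K2 where K2: "\<And>n. n * (?q - \<delta>/2) - S n x \<le> K2"
      using nx xM by (auto simp: unbounded_sums_iff s2 not_less)
    define K where "K = max K1 K2"
    \<comment> \<open>Chosen so that K < n \<delta>/2 for n > N, which turns the bound n \<delta>/2
      + K on the deviation into less than n \<delta>.\<close>
    obtain N :: nat where N: "2 * K / \<delta> < N" using reals_Archimedean2 by blast
    obtain n where n: "n \<ge> Suc N" "x \<in> D n" using x by (auto simp: G_def)
    have npos: "0 < real n" using n by simp
    have "2 * K / \<delta> < n" using N n by linarith
    then have "2 * K < n * \<delta>" using \<open>\<delta> > 0\<close> by (simp add: divide_less_eq)
    moreover have "\<bar>S n x - n * ?q\<bar> \<le> n * \<delta> / 2 + K"
      using K1[of n] K2[of n] by (auto simp: K_def abs_le_iff algebra_simps)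
    ultimately have "\<bar>S n x - n * ?q\<bar> < n * \<delta>" by linarith
    moreover have "1 / real n * S n x - ?q = (S n x - n * ?q) / n" using npos by (simp add: field_simps)
    ultimately have "\<bar>1 / real n * S n x - ?q\<bar> < \<delta>" using npos by (simp add: divide_less_eq mult.commute)
    then show False using n by (simp add: D_def)
  qed
  have "V (\<Inter>n. G n) \<le> V (unbounded_sums M T f1 \<union> unbounded_sums M T f2)"
    using GM UM sub by (intro upper_probability_mono[OF V]) auto
  also have "\<dots> \<le> 0" using upper_probability_subadditive[OF V UM] null by simp
  finally have "V (\<Inter>n. G n) = 0"
    using upper_probability_nonneg[OF V, of "\<Inter>n. G n"] GM by auto
  moreover have "decseq G" unfolding G_def decseq_def by fastforce
  ultimately have G0: "(\<lambda>n. V (G n)) \<longlonglongrightarrow> 0"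
    using GM by (intro upper_probability_continuous_null[OF V]) auto
  have "(\<lambda>n. V (D n)) \<longlonglongrightarrow> 0"
  proof (rule real_tendsto_sandwich[OF _ _ tendsto_const G0])
    show "\<forall>\<^sub>F n in sequentially. V (D n) \<le> V (G n)"
      using GM by (intro always_eventually allI upper_probability_mono[OF V]) (auto simp: G_def)
  qed (simp add: upper_probability_nonneg[OF V])
  then show ?thesis by (simp add: D_def S_def)
qed

text \<open>The averages concentrate at \<open>measure Q C\<close>. The level set at t is thus close
  to \<open>B\<close> for t between 0 and that value and close to empty above it, and integrating
  over t gives the product.\<close>

lemma choquet_averages_tendsto:
  assumes B[measurable]: "B \<in> sets M" and C[measurable]: "C \<in> sets M"
  shows "(\<lambda>n. choquet M V (\<lambda>x. (1 / real n) * (\<Sum>i<n. indicator B x * indicator C ((T ^^ i) x))))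
           \<longlonglongrightarrow> V B * measure Q C"
proof -
  note [measurable] = measurable_funpow[OF T]
  let ?q = "measure Q C"
  define A :: "nat \<Rightarrow> 'a \<Rightarrow> real" where "A n x = 1 / real n * (\<Sum>i<n. indicator C ((T ^^ i) x))" for n x
  define F :: "nat \<Rightarrow> 'a \<Rightarrow> real"
    where "F n x = (1 / real n) * (\<Sum>i<n. indicator B x * indicator C ((T ^^ i) x))" for n x
  define L where "L n t = {x \<in> space M. t \<le> F n x}" for n t
  have FA: "F n x = indicator B x * A n x" for n x
    by (simp only: F_def A_def sum_distrib_left mult_ac)
  have [measurable]: "A n \<in> borel_measurable M" for n unfolding A_def by measurable
  have [measurable]: "F n \<in> borel_measurable M" for n unfolding F_def by measurable
  have LM[measurable]: "L n t \<in> sets M" for n t unfolding L_def by measurable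
  have A01: "0 \<le> A n x" "A n x \<le> 1" for n x
  proof -
    show "0 \<le> A n x" by (auto simp: A_def intro!: divide_nonneg_nonneg sum_nonneg)
    have "(\<Sum>i<n. indicator C ((T ^^ i) x)) \<le> (\<Sum>i<n. (1::real))"
      by (intro sum_mono) (simp add: indicator_def)
    \<comment> \<open>For n = 0 the average is 0 because division by zero yields 0.\<close>
    then show "A n x \<le> 1" by (cases "n = 0") (auto simp: A_def divide_le_eq)
  qed
  have F01: "0 \<le> F n x" "F n x \<le> 1" for n x
    using A01[of n x] by (auto simp: FA indicator_def)
  have Lneg: "L n t = space M" if "t \<le> 0" for n t
    using that F01 by (auto simp: L_def intro: order_trans)
  have Lbig: "L n t = {}" if "t > 1" for n t
    using that F01(2)[of n] by (auto simp: L_def dest!: order_trans[of t "F n _" 1])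
  have LV[measurable]: "(\<lambda>t. V (L n t)) \<in> borel_measurable borel" for n
  proof -
    \<comment> \<open>Level sets shrink as t grows, so measurability in t comes from
      monotonicity.\<close>
    have "mono (\<lambda>t. - V (L n t))"
      by (intro monoI) (auto intro!: upper_probability_mono[OF V] simp: L_def)
    from borel_measurable_uminus[OF borel_measurable_mono[OF this]] show ?thesis by simp
  qed
  have ch: "choquet M V (F n) = (\<integral>t. indicator {0..} t * V (L n t) \<partial>lborel)" for n
  proof -
    have "(LBINT t:{..<0}. V {x\<in>space M. t \<le> F n x} - 1) = (LBINT t:{..<0::real}. 0)"
      using Lneg[of _ n] upper_probability_space[OF V]
      by (intro set_lebesgue_integral_cong) (auto simp: L_def)
    then show ?thesis by (simp add: choquet_def set_lebesgue_integral_def L_def)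
  qed
  have pw: "(\<lambda>n. V (L n t)) \<longlonglongrightarrow> (if t < ?q then V B else 0)" if t: "t > 0" "t \<noteq> ?q" for t
  proof -
    define \<delta> where "\<delta> = \<bar>t - ?q\<bar>"
    define D where "D n = {x \<in> space M. \<delta> \<le> \<bar>A n x - ?q\<bar>}" for n
    \<comment> \<open>Outside \<open>D n\<close> the average lies on the same side of t as
      \<open>?q\<close>, so the level set there coincides with \<open>W\<close>.\<close>
    define W where "W = (if t < ?q then B else {})"
    have "\<delta> > 0" using t by (simp add: \<delta>_def)
    have DM: "D n \<in> sets M" for n unfolding D_def by measurable
    have WM: "W \<in> sets M" by (simp add: W_def)
    have D0: "(\<lambda>n. V (D n)) \<longlonglongrightarrow> 0"
      using averages_converge_in_upper_probability[OF C \<open>\<delta> > 0\<close>] by (simp add: D_def A_def)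
    have "\<bar>V (L n t) - V W\<bar> \<le> V (D n)" for n
    proof (rule upper_probability_diff_le[OF V LM WM DM])
      show "L n t \<subseteq> W \<union> D n"
        using t by (auto simp: L_def W_def D_def FA \<delta>_def indicator_def split: if_splits)
      show "W \<subseteq> L n t \<union> D n"
        using t sets.sets_into_space[OF B]
        by (auto simp: L_def W_def D_def FA \<delta>_def indicator_def split: if_splits)
    qed
    then have "(\<lambda>n. V (L n t) - V W) \<longlonglongrightarrow> 0"
      by (intro tendsto_rabs_zero_cancel[OF real_tendsto_sandwich[OF _ _ tendsto_const D0]]) auto
    then show ?thesis
      using upper_probability_empty[OF V] by (auto simp: W_def LIM_zero_iff split: if_splits)
  qed
  have "(\<lambda>n. \<integral>t. indicator {0..} t * V (L n t) \<partial>lborel)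
          \<longlonglongrightarrow> (\<integral>t. indicator {0..?q} t * V B \<partial>lborel)"
  \<comment> \<open>Domination holds as \<open>V\<close> \<le> 1 and the level sets are empty for t
    > 1.\<close>
  proof (rule integral_dominated_convergence[where w="indicator {0..1::real}"])
    \<comment> \<open>At t = 0 the level set is the whole space, and at \<open>?q\<close>
      concentration decides nothing; two points are negligible.\<close>
    have "AE t in lborel. t \<noteq> 0 \<and> t \<noteq> ?q"
      using AE_lborel_singleton[of 0] AE_lborel_singleton[of ?q] by eventually_elim auto
    then show "AE t in lborel. (\<lambda>n. indicator {0..} t * V (L n t)) \<longlonglongrightarrow> indicator {0..?q} t * V B"
    proof eventually_elim
      case (elim t)
      show ?case
      proof (cases "t > 0")
        case True
        then show ?thesis using pw[OF True] elim by (auto simp: indicator_def split: if_splits)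
      qed (use elim in \<open>auto simp: indicator_def\<close>)
    qed
    show "AE t in lborel. norm (indicator {0..} t * V (L n t)) \<le> indicator {0..1::real} t" for n
      using upper_probability_nonneg[OF V LM] upper_probability_le_1[OF V LM] Lbig upper_probability_empty[OF V]
      by (intro AE_I2) (auto simp: indicator_def not_le)
  qed auto
  moreover have "(\<integral>t. indicator {0..?q} t * V B \<partial>lborel) = V B * ?q" by simp
  ultimately have "(\<lambda>n. choquet M V (F n)) \<longlonglongrightarrow> V B * ?q" by (simp add: ch mult.commute)
  then show ?thesis unfolding F_def[abs_def] .
qed

text \<open>If \<open>V\<close> is additive, its values on \<open>C\<close> and the complement sum
  to 1, as do those of \<open>Q\<close>. Since \<open>Q\<close> \<le> \<open>V\<close> on both sets,
  equality is forced.\<close>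

lemma sigma_additive_iff_eq_measure:
  "sigma_additive_cap M V \<longleftrightarrow> (\<forall>C\<in>sets M. V C = measure Q C)"
proof
  assume *: "\<forall>C\<in>sets M. V C = measure Q C"
  show "sigma_additive_cap M V"
    unfolding sigma_additive_cap_def
  proof (intro allI impI)
    fix A :: "nat \<Rightarrow> 'a set" assume A: "range A \<subseteq> sets M" "disjoint_family A"
    then have "(\<lambda>n. measure Q (A n)) sums measure Q (\<Union>n. A n)"
      by (intro Q.finite_measure_UNION) (auto simp: sets_Q)
    moreover have "A n \<in> sets M" "(\<Union>n. A n) \<in> sets M" for n using A by auto
    ultimately show "(\<lambda>n. V (A n)) sums V (\<Union>n. A n)" using * by simp
  qed
next
  assume sa: "sigma_additive_cap M V"
  show "\<forall>C\<in>sets M. V C = measure Q C"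
  proof
    fix C assume C: "C \<in> sets M"
    define D where "D = space M - C"
    have D: "D \<in> sets M" using C by (simp add: D_def)
    \<comment> \<open>Pads the two sets with empty ones to a sequence.\<close>
    let ?A = "binaryset C D"
    have "range ?A \<subseteq> sets M" using C D by (auto simp: binaryset_def)
    moreover have "disjoint_family ?A" by (auto simp: disjoint_family_on_def binaryset_def D_def)
    ultimately have "(\<lambda>n. V (?A n)) sums V (C \<union> D)"
      using sa unfolding sigma_additive_cap_def by (metis UN_binaryset_eq)
    moreover have "(\<lambda>n. V (?A n)) sums (V C + V D)"
      by (rule binaryset_sums) (rule upper_probability_empty[OF V])
    moreover have "C \<union> D = space M" using sets.sets_into_space[OF C] by (auto simp: D_def)
    ultimately have "V C + V D = 1" using sums_unique2 upper_probability_space[OF V] by metis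
    moreover have "measure Q D = 1 - measure Q C"
      using C Q.prob_compl[of C] by (simp add: D_def sets_Q sets_eq_imp_space_eq[OF sets_Q])
    ultimately show "V C = measure Q C" using bspec[OF Q_le C] bspec[OF Q_le D] by linarith
  qed
qed

end

theorem proposition4p2:
  fixes M :: "'a measure" and T :: "'a \<Rightarrow> 'a" and V :: "'a set \<Rightarrow> real"
  assumes "T \<in> M \<rightarrow>\<^sub>M M"
    and "upper_probability M V"
    and "T_invariant M T V"
    and "ergodic_cap M T V"
  shows "(\<forall>B\<in>sets M. \<forall>C\<in>sets M.
            (\<lambda>n. choquet M V (\<lambda>\<omega>. (1 / real n) *
                 (\<Sum>i<n. indicator B \<omega> * indicator C ((T ^^ i) \<omega>))))
            \<longlonglongrightarrow> V B * V C)
         \<longleftrightarrow> sigma_additive_cap M V"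
proof -
  obtain Q where Q: "prob_space Q" "sets Q = sets M" "\<forall>A\<in>sets M. measure Q A \<le> V A"
    "T_invariant M T (measure Q)"
    using invariant_probability_below[OF assms(1-3)] by blast
  note lim = choquet_averages_tendsto[OF assms(1,2,4) Q]
  note add_iff = sigma_additive_iff_eq_measure[OF assms(1,2,4) Q]
  show ?thesis
  proof
    assume *: "\<forall>B\<in>sets M. \<forall>C\<in>sets M.
            (\<lambda>n. choquet M V (\<lambda>\<omega>. (1 / real n) *
                 (\<Sum>i<n. indicator B \<omega> * indicator C ((T ^^ i) \<omega>))))
            \<longlonglongrightarrow> V B * V C"
    \<comment> \<open>Take \<open>B\<close> to be the whole space, where \<open>V\<close> is 1, and
      compare the two limits.\<close>
    have "V C = measure Q C" if "C \<in> sets M" for C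
      using LIMSEQ_unique[OF *[rule_format, OF sets.top that] lim[OF sets.top that]]
        upper_probability_space[OF assms(2)] by simp
    then show "sigma_additive_cap M V" using add_iff by blast
  next
    assume "sigma_additive_cap M V"
    then show "\<forall>B\<in>sets M. \<forall>C\<in>sets M.
            (\<lambda>n. choquet M V (\<lambda>\<omega>. (1 / real n) *
                 (\<Sum>i<n. indicator B \<omega> * indicator C ((T ^^ i) \<omega>))))
            \<longlonglongrightarrow> V B * V C"
      using lim add_iff by simp
  qed
qed

end
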